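(* Let $(S,\triangleright)$ be a left shelf and $(T,\triangleleft)$ a right shelf, let $r_S$ and $r_T$ be the solutions associated with $(S,\triangleright)$ and $(T,\triangleleft)$, respectively, i.e. $r_S(a,b)=(b,\,b\triangleright a)$ and $r_T(u,v)=(v\triangleleft u,\,u)$, and let $\alpha:T\to \mathrm{Sym}(S)$ and $\beta:S\to\mathrm{Sym}(T)$ be maps. Write $\alpha_u=\alpha(u)$ and $\beta_a=\beta(a)$ for $u\in T$, $a\in S$. Then the quadruple $(r_S,r_T,\alpha,\beta)$ is a matched product system of solutions if and only if every $\alpha_u$ ($u\in T$) is a homomorphism of left shelves, every $\beta_a$ ($a\in S$) is a homomorphism of right shelves and, for all $a,b\in S$ and $u,v\in T$, $$\alpha_{u\triangleleft v}=\alpha_u\alpha_v\alpha_u^{-1},\qquad \beta_{b\triangleright a}=\beta_b^{-1}\beta_a\beta_b,\qquad \alpha_u=\alpha_{\beta_a^{-1}(u)},\qquad \beta_a=\beta_{\alpha_u^{-1}(a)}.$$ In particular, the matched product $r_S\bowtie r_T$ (for $(r_S,r_T,\alpha,\beta)$ a matched product system of solutions) is given by $$(r_S\bowtie r_T)\big((a,u),(b,v)\big)=\Big(\big(\alpha_u(b),\ \beta_a(v)\triangleleft u\big),\ \big(\alpha^{-1}_{v\triangleleft u}(\alpha_u(b)\triangleright a),\ \beta_b^{-1}(u)\big)\Big)$$ for all $a,b\in S$, $u,v\in T$, and $r_S\bowtie r_T$ is left non-degenerate if and only if $(T,\triangleleft)$ is a right rack.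
   Context: Solutions. A (set-theoretical) solution on a set $X$ is a map $r:X\times X\to X\times X$ with $(r\times\mathrm{id}_X)(\mathrm{id}_X\times r)(r\times\mathrm{id}_X)=(\mathrm{id}_X\times r)(r\times\mathrm{id}_X)(\mathrm{id}_X\times r)$. Write $r(x,y)=(\lambda_x(y),\rho_y(x))$. The solution $r$ is left non-degenerate if every $\lambda_x$ is bijective. Shelves. A left shelf is a set $X$ with a binary operation $\triangleright$ such that $x\triangleright(y\triangleright z)=(x\triangleright y)\triangleright(x\triangleright z)$ for all $x,y,z$; its associated solution is $r_\triangleright(x,y)=(y,\,y\triangleright x)$. A right shelf is a set $X$ with a binary operation $\triangleleft$ such that $(x\triangleleft y)\triangleleft z=(x\triangleleft z)\triangleleft(y\triangleleft z)$ for all $x,y,z$; its associated solution is $r_\triangleleft(x,y)=(y\triangleleft x,\,x)$. A right rack is a right shelf in which every map $R_y:X\to X$, $R_y(x)=x\triangleleft y$, is bijective. Homomorphisms of left (right) shelves are maps preserving $\triangleright$ (respectively $\triangleleft$). $\mathrm{Sym}(X)$ is the group of bijections $X\to X$; juxtaposition of maps is composition, $fg=f\circ g$. Matched product systems. Given solutions $r_S$ on $S$ and $r_T$ on $T$ (components of both written $\lambda,\rho$, with $a,b\in S$ and $u,v\in T$) and maps $\alpha:T\to\mathrm{Sym}(S)$, $\beta:S\to\mathrm{Sym}(T)$, with $\alpha_u:=\alpha(u)$, $\beta_a:=\beta(a)$, the quadruple $(r_S,r_T,\alpha,\beta)$ is a matched product system of solutions if for all $a,b\in S$, $u,v\in T$: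 (s1) $\alpha_u\alpha_v=\alpha_{\lambda_u(v)}\alpha_{\rho_v(u)}$; (s2) $\beta_a\beta_b=\beta_{\lambda_a(b)}\beta_{\rho_b(a)}$; (s3) $\rho_{\alpha_u^{-1}(b)}\big(\alpha^{-1}_{\beta_a(u)}(a)\big)=\alpha^{-1}_{\beta_{\rho_b(a)}\beta_b^{-1}(u)}\big(\rho_b(a)\big)$; (s4) $\rho_{\beta_a^{-1}(v)}\big(\beta^{-1}_{\alpha_u(a)}(u)\big)=\beta^{-1}_{\alpha_{\rho_v(u)}\alpha_v^{-1}(a)}\big(\rho_v(u)\big)$; (s5) $\lambda_a\alpha_{\beta_a^{-1}(u)}=\alpha_u\lambda_{\alpha_u^{-1}(a)}$; (s6) $\lambda_u\beta_{\alpha_u^{-1}(a)}=\beta_a\lambda_{\beta_a^{-1}(u)}$. Matched product. For a matched product system, the matched product solution $r_S\bowtie r_T$ is the map on $(S\times T)\times(S\times T)$ (known to be a solution on $S\times T$) $$\big((a,u),(b,v)\big)\mapsto\Big(\big(A,U\big),\ \big(\alpha^{-1}_{\overline U}(\rho_{\alpha_{\bar u}(b)}(a)),\ \beta^{-1}_{\overline A}(\rho_{\beta_{\bar a}(v)}(u))\big)\Big),$$ where $\bar a=\alpha_u^{-1}(a)$, $\bar u=\beta_a^{-1}(u)$, $A=\alpha_u(\lambda_{\bar a}(b))$, $U=\beta_a(\lambda_{\bar u}(v))$, $\overline A=\alpha_U^{-1}(A)$, $\overline U=\beta_A^{-1}(U)$.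
   Formalization: The first condition is corrected to α_{v◁u} = α_u α_v α_u^{-1} (the printed α_{u◁v} is false, e.g. for conjugation on Sym(3) with α the identity and β trivial); S and T are taken nonempty. *)

theory Defs
  imports Main
begin

text \<open>
  The underlying sets of shelves and solutions are types, hence nonempty.  An element of
  \<open>Sym(X)\<close> is a function \<open>f :: 'x \<Rightarrow> 'x\<close> with \<^term>\<open>bij f\<close>, its inverse being \<^term>\<open>inv f\<close>.
\<close>

definition on_first_two :: "('x \<times> 'x \<Rightarrow> 'x \<times> 'x) \<Rightarrow> 'x \<times> 'x \<times> 'x \<Rightarrow> 'x \<times> 'x \<times> 'x" where
  "on_first_two r = (\<lambda>(x, y, z). (fst (r (x, y)), snd (r (x, y)), z))"

definition on_last_two :: "('x \<times> 'x \<Rightarrow> 'x \<times> 'x) \<Rightarrow> 'x \<times> 'x \<times> 'x \<Rightarrow> 'x \<times> 'x \<times> 'x" where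
  "on_last_two r = (\<lambda>(x, y, z). (x, r (y, z)))"

definition solution :: "('x \<times> 'x \<Rightarrow> 'x \<times> 'x) \<Rightarrow> bool" where
  "solution r \<longleftrightarrow>
     on_first_two r \<circ> on_last_two r \<circ> on_first_two r
     = on_last_two r \<circ> on_first_two r \<circ> on_last_two r"

text \<open>
  For \<open>r (x, y) = (\<lambda>\<^sub>x(y), \<rho>\<^sub>y(x))\<close>, the map \<open>\<lambda>\<^sub>x\<close> is \<open>lam r x\<close> and \<open>\<rho>\<^sub>y\<close> is \<open>rho r y\<close>;
  note the argument order of the latter.
\<close>

definition lam :: "('x \<times> 'x \<Rightarrow> 'x \<times> 'x) \<Rightarrow> 'x \<Rightarrow> 'x \<Rightarrow> 'x" where
  "lam r x y = fst (r (x, y))"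

definition rho :: "('x \<times> 'x \<Rightarrow> 'x \<times> 'x) \<Rightarrow> 'x \<Rightarrow> 'x \<Rightarrow> 'x" where
  "rho r y x = snd (r (x, y))"

definition left_nondegenerate :: "('x \<times> 'x \<Rightarrow> 'x \<times> 'x) \<Rightarrow> bool" where
  "left_nondegenerate r \<longleftrightarrow> (\<forall>x. bij (lam r x))"

definition left_shelf :: "('x \<Rightarrow> 'x \<Rightarrow> 'x) \<Rightarrow> bool" where
  "left_shelf f \<longleftrightarrow> (\<forall>x y z. f x (f y z) = f (f x y) (f x z))"

definition right_shelf :: "('x \<Rightarrow> 'x \<Rightarrow> 'x) \<Rightarrow> bool" where
  "right_shelf g \<longleftrightarrow> (\<forall>x y z. g (g x y) z = g (g x z) (g y z))"

definition right_rack :: "('x \<Rightarrow> 'x \<Rightarrow> 'x) \<Rightarrow> bool" where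
  "right_rack g \<longleftrightarrow> right_shelf g \<and> (\<forall>y. bij (\<lambda>x. g x y))"

definition shelf_hom :: "('x \<Rightarrow> 'x \<Rightarrow> 'x) \<Rightarrow> ('y \<Rightarrow> 'y \<Rightarrow> 'y) \<Rightarrow> ('x \<Rightarrow> 'y) \<Rightarrow> bool" where
  "shelf_hom f g h \<longleftrightarrow> (\<forall>x y. h (f x y) = g (h x) (h y))"

definition left_shelf_solution :: "('x \<Rightarrow> 'x \<Rightarrow> 'x) \<Rightarrow> 'x \<times> 'x \<Rightarrow> 'x \<times> 'x" where
  "left_shelf_solution f = (\<lambda>(x, y). (y, f y x))"

definition right_shelf_solution :: "('x \<Rightarrow> 'x \<Rightarrow> 'x) \<Rightarrow> 'x \<times> 'x \<Rightarrow> 'x \<times> 'x" where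
  "right_shelf_solution g = (\<lambda>(x, y). (g y x, x))"

definition matched_product_system ::
  "('s \<times> 's \<Rightarrow> 's \<times> 's) \<Rightarrow> ('t \<times> 't \<Rightarrow> 't \<times> 't) \<Rightarrow> ('t \<Rightarrow> 's \<Rightarrow> 's) \<Rightarrow> ('s \<Rightarrow> 't \<Rightarrow> 't) \<Rightarrow> bool"
where
  "matched_product_system rS rT \<alpha> \<beta> \<longleftrightarrow>
     solution rS \<and> solution rT \<and> (\<forall>u. bij (\<alpha> u)) \<and> (\<forall>a. bij (\<beta> a)) \<and>
     (\<forall>u v. \<alpha> u \<circ> \<alpha> v = \<alpha> (lam rT u v) \<circ> \<alpha> (rho rT v u)) \<and>
     (\<forall>a b. \<beta> a \<circ> \<beta> b = \<beta> (lam rS a b) \<circ> \<beta> (rho rS b a)) \<and>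
     (\<forall>a b u. rho rS (inv (\<alpha> u) b) (inv (\<alpha> (\<beta> a u)) a)
        = inv (\<alpha> (\<beta> (rho rS b a) (inv (\<beta> b) u))) (rho rS b a)) \<and>
     (\<forall>a u v. rho rT (inv (\<beta> a) v) (inv (\<beta> (\<alpha> u a)) u)
        = inv (\<beta> (\<alpha> (rho rT v u) (inv (\<alpha> v) a))) (rho rT v u)) \<and>
     (\<forall>a u. lam rS a \<circ> \<alpha> (inv (\<beta> a) u) = \<alpha> u \<circ> lam rS (inv (\<alpha> u) a)) \<and>
     (\<forall>a u. lam rT u \<circ> \<beta> (inv (\<alpha> u) a) = \<beta> a \<circ> lam rT (inv (\<beta> a) u))"

text \<open>
  In the next definition \<open>a'\<close>, \<open>u'\<close>, \<open>A'\<close>, \<open>U'\<close> are the barred elements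
  \<open>\<alpha>\<^sub>u\<^sup>-\<^sup>1(a)\<close>, \<open>\<beta>\<^sub>a\<^sup>-\<^sup>1(u)\<close>, \<open>\<alpha>\<^sub>U\<^sup>-\<^sup>1(A)\<close>, \<open>\<beta>\<^sub>A\<^sup>-\<^sup>1(U)\<close>.
\<close>

definition matched_product ::
  "('s \<times> 's \<Rightarrow> 's \<times> 's) \<Rightarrow> ('t \<times> 't \<Rightarrow> 't \<times> 't) \<Rightarrow> ('t \<Rightarrow> 's \<Rightarrow> 's) \<Rightarrow> ('s \<Rightarrow> 't \<Rightarrow> 't) \<Rightarrow>
   ('s \<times> 't) \<times> ('s \<times> 't) \<Rightarrow> ('s \<times> 't) \<times> ('s \<times> 't)"
where
  "matched_product rS rT \<alpha> \<beta> = (\<lambda>((a, u), (b, v)).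
     let a' = inv (\<alpha> u) a;
         u' = inv (\<beta> a) u;
         A = \<alpha> u (lam rS a' b);
         U = \<beta> a (lam rT u' v);
         A' = inv (\<alpha> U) A;
         U' = inv (\<beta> A) U
     in ((A, U),
         (inv (\<alpha> U') (rho rS (\<alpha> u' b) a), inv (\<beta> A') (rho rT (\<beta> a' v) u))))"

end

theory Submission
  imports Defs
begin

text \<open>
  For the two shelf solutions, one of \<open>\<lambda>\<close>, \<open>\<rho>\<close> is trivial: \<open>\<lambda>\<^sub>a = id\<close> and
  \<open>\<rho>\<^sub>b(a) = b \<triangleright> a\<close> on \<open>S\<close>, while \<open>\<lambda>\<^sub>u(v) = v \<triangleleft> u\<close> and \<open>\<rho>\<^sub>v(u) = u\<close> on \<open>T\<close>.
  Hence the first two axioms of a matched product system become the two conjugation rules, and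
  the fifth one becomes the invariance \<open>\<alpha>\<^sub>u = \<alpha>\<^bsub>\<beta>\<^sub>a\<^sup>-\<^sup>1(u)\<^esub>\<close>.  Once \<open>\<alpha>\<close> is constant along
  the maps \<open>\<beta>\<^sub>a\<close>, all the \<open>\<alpha>\<close>'s in the third axiom equal \<open>\<alpha>\<^sub>u\<close>, and the axiom says that
  \<open>\<alpha>\<^sub>u\<^sup>-\<^sup>1\<close> is a shelf homomorphism.

  The point that is not a rewriting is the invariance of \<open>\<beta>\<close> along \<open>\<alpha>\<close>.  The fourth axiom
  gives only equations whose outer map and whose argument are tied to the same \<open>u\<close>; the case
  \<open>u = v\<close> is what separates them (\<open>invariance_of_pointwise\<close>).  After that, the sixth axiom
  involves a single \<open>\<beta>\<^sub>a\<close> and says that it is a homomorphism.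

  The invariances also remove the barred indices of the matched product, so that
  \<open>\<lambda>\<^bsub>(a,u)\<^esub>\<close> becomes the product of the bijection \<open>\<alpha>\<^sub>u\<close> with \<open>v \<mapsto> \<beta>\<^sub>a(v) \<triangleleft> u\<close>, which is
  bijective exactly when the right translation by \<open>u\<close> is.
\<close>

lemma solution_left_shelf_solution:
  assumes "left_shelf f"
  shows "solution (left_shelf_solution f)"
  using assms
  by (auto simp: solution_def left_shelf_def left_shelf_solution_def
      on_first_two_def on_last_two_def fun_eq_iff)

lemma solution_right_shelf_solution:
  assumes "right_shelf g"
  shows "solution (right_shelf_solution g)"
  using assms
  by (auto simp: solution_def right_shelf_def right_shelf_solution_def
      on_first_two_def on_last_two_def fun_eq_iff)

lemma shelf_hom_inv_iff:
  assumes "bij h"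
  shows "shelf_hom f g h \<longleftrightarrow> (\<forall>x y. inv h (g x y) = f (inv h x) (inv h y))"
  unfolding shelf_hom_def
  by (metis assms bij_inv_eq_iff)

lemma bij_map_prod_iff:
  "bij (map_prod f g) \<longleftrightarrow> bij f \<and> bij g"
proof
  assume "bij (map_prod f g)"
  then have "inj (map_prod f g)" and "surj (map_prod f g)"
    by (auto simp: bij_def)
  then show "bij f \<and> bij g"
    by (auto simp: bij_def inj_def surj_def)
next
  assume "bij f \<and> bij g"
  then show "bij (map_prod f g)"
    by (auto simp: bij_def prod.inj_map map_prod_surj)
qed

text \<open>
  The hypothesis is the fourth axiom.  With \<open>v = u\<close> it reads
  \<open>\<beta>\<^bsub>\<alpha>\<^sub>u(a)\<^esub>\<^sup>-\<^sup>1(u) = \<beta>\<^sub>a\<^sup>-\<^sup>1(u)\<close> for every \<open>a\<close>; this strips the outer \<open>\<alpha>\<^sub>u\<close> from both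
  indices of the general case, and what is left holds for \<open>u\<close> and \<open>v\<close> independently.
\<close>
lemma invariance_of_pointwise:
  assumes bij_\<alpha>: "\<And>u. bij (\<alpha> u)" and bij_\<beta>: "\<And>a. bij (\<beta> a)"
    and eq: "\<And>a u v. inv (\<beta> (\<alpha> u a)) u = inv (\<beta> (\<alpha> u (inv (\<alpha> v) a))) u"
  shows "\<beta> (inv (\<alpha> v) a) = \<beta> a"
proof -
  have diagonal: "inv (\<beta> (\<alpha> u b)) u = inv (\<beta> b) u" for b u
    using eq[of u b u] bij_\<alpha>[of u] by (simp add: bij_is_surj surj_f_inv_f)
  have "inv (\<beta> (inv (\<alpha> v) a)) u = inv (\<beta> a) u" for u
    using eq[of u a v] by (simp add: diagonal)
  then have "inv (\<beta> (inv (\<alpha> v) a)) = inv (\<beta> a)"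
    by blast
  then show ?thesis
    by (metis bij_\<beta> inv_inv_eq)
qed

locale shelf_pair =
  fixes ls :: "'s \<Rightarrow> 's \<Rightarrow> 's"  (infixr "\<triangleright>" 70)
    and rs :: "'t \<Rightarrow> 't \<Rightarrow> 't"  (infixl "\<triangleleft>" 70)
    and \<alpha> :: "'t \<Rightarrow> 's \<Rightarrow> 's"
    and \<beta> :: "'s \<Rightarrow> 't \<Rightarrow> 't"
  assumes left_shelf: "left_shelf (\<triangleright>)"
    and right_shelf: "right_shelf (\<triangleleft>)"
    and bij_\<alpha>: "\<And>u. bij (\<alpha> u)"
    and bij_\<beta>: "\<And>a. bij (\<beta> a)"
begin

abbreviation rS where "rS \<equiv> left_shelf_solution (\<triangleright>)"
abbreviation rT where "rT \<equiv> right_shelf_solution (\<triangleleft>)"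

lemma \<alpha>_cancel [simp]: "\<alpha> u (inv (\<alpha> u) a) = a" "inv (\<alpha> u) (\<alpha> u a) = a"
  using bij_\<alpha>[of u] by (simp_all add: bij_is_surj surj_f_inv_f bij_is_inj inv_f_f)

lemma \<beta>_cancel [simp]: "\<beta> a (inv (\<beta> a) u) = u" "inv (\<beta> a) (\<beta> a u) = u"
  using bij_\<beta>[of a] by (simp_all add: bij_is_surj surj_f_inv_f bij_is_inj inv_f_f)

lemma components:
  "lam rS a b = b" "rho rS b a = b \<triangleright> a" "lam rT u v = v \<triangleleft> u" "rho rT v u = u"
  by (simp_all add: lam_def rho_def left_shelf_solution_def right_shelf_solution_def)

text \<open>Each equation is the axiom of a matched product system in the corresponding place.\<close>
lemma matched_product_system_iff_axioms:
  "matched_product_system rS rT \<alpha> \<beta> \<longleftrightarrow>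
     (\<forall>u v x. \<alpha> u (\<alpha> v x) = \<alpha> (v \<triangleleft> u) (\<alpha> u x)) \<and>
     (\<forall>a b y. \<beta> a (\<beta> b y) = \<beta> b (\<beta> (b \<triangleright> a) y)) \<and>
     (\<forall>a b u. inv (\<alpha> u) b \<triangleright> inv (\<alpha> (\<beta> a u)) a
        = inv (\<alpha> (\<beta> (b \<triangleright> a) (inv (\<beta> b) u))) (b \<triangleright> a)) \<and>
     (\<forall>a u v. inv (\<beta> (\<alpha> u a)) u = inv (\<beta> (\<alpha> u (inv (\<alpha> v) a))) u) \<and>
     (\<forall>a u. \<alpha> (inv (\<beta> a) u) = \<alpha> u) \<and>
     (\<forall>a u y. \<beta> (inv (\<alpha> u) a) y \<triangleleft> u = \<beta> a (y \<triangleleft> inv (\<beta> a) u))"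
  unfolding matched_product_system_def
  using solution_left_shelf_solution[OF left_shelf] solution_right_shelf_solution[OF right_shelf]
    bij_\<alpha> bij_\<beta>
  by (simp add: components fun_eq_iff)

lemma \<alpha>_conjugation_iff:
  "(\<forall>u v x. \<alpha> u (\<alpha> v x) = \<alpha> (v \<triangleleft> u) (\<alpha> u x)) \<longleftrightarrow>
     (\<forall>u v. \<alpha> (v \<triangleleft> u) = \<alpha> u \<circ> \<alpha> v \<circ> inv (\<alpha> u))"
  by (simp add: fun_eq_iff) (metis \<alpha>_cancel)

lemma \<beta>_conjugation_iff:
  "(\<forall>a b y. \<beta> a (\<beta> b y) = \<beta> b (\<beta> (b \<triangleright> a) y)) \<longleftrightarrow>
     (\<forall>a b. \<beta> (b \<triangleright> a) = inv (\<beta> b) \<circ> \<beta> a \<circ> \<beta> b)"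
  by (simp add: fun_eq_iff) (metis \<beta>_cancel)

lemma \<alpha>_invariant:
  assumes "\<And>a u. \<alpha> (inv (\<beta> a) u) = \<alpha> u"
  shows "\<alpha> (\<beta> a u) = \<alpha> u"
  using assms[of a "\<beta> a u"] by simp

lemma \<beta>_invariant:
  assumes "\<And>u a. \<beta> (inv (\<alpha> u) a) = \<beta> a"
  shows "\<beta> (\<alpha> u a) = \<beta> a"
  using assms[of u "\<alpha> u a"] by simp

lemma \<alpha>_hom_iff:
  assumes inv_\<alpha>: "\<And>a u. \<alpha> (inv (\<beta> a) u) = \<alpha> u"
  shows "(\<forall>a b u. inv (\<alpha> u) b \<triangleright> inv (\<alpha> (\<beta> a u)) a
      = inv (\<alpha> (\<beta> (b \<triangleright> a) (inv (\<beta> b) u))) (b \<triangleright> a)) \<longleftrightarrow>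
    (\<forall>u. shelf_hom (\<triangleright>) (\<triangleright>) (\<alpha> u))"
  by (auto simp: inv_\<alpha> \<alpha>_invariant[OF inv_\<alpha>] shelf_hom_inv_iff[OF bij_\<alpha>])

lemma \<beta>_hom_iff:
  assumes inv_\<beta>: "\<And>u a. \<beta> (inv (\<alpha> u) a) = \<beta> a"
  shows "(\<forall>a u y. \<beta> (inv (\<alpha> u) a) y \<triangleleft> u = \<beta> a (y \<triangleleft> inv (\<beta> a) u)) \<longleftrightarrow>
    (\<forall>a. shelf_hom (\<triangleleft>) (\<triangleleft>) (\<beta> a))"
  unfolding shelf_hom_def inv_\<beta> by (metis \<beta>_cancel)

lemma \<beta>_invariance_iff:
  "(\<forall>a u v. inv (\<beta> (\<alpha> u a)) u = inv (\<beta> (\<alpha> u (inv (\<alpha> v) a))) u) \<longleftrightarrow>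
     (\<forall>u a. \<beta> (inv (\<alpha> u) a) = \<beta> a)"
proof
  assume "\<forall>a u v. inv (\<beta> (\<alpha> u a)) u = inv (\<beta> (\<alpha> u (inv (\<alpha> v) a))) u"
  then show "\<forall>u a. \<beta> (inv (\<alpha> u) a) = \<beta> a"
    using invariance_of_pointwise[of \<alpha> \<beta>, OF bij_\<alpha> bij_\<beta>] by blast
next
  assume "\<forall>u a. \<beta> (inv (\<alpha> u) a) = \<beta> a"
  then have inv_\<beta>: "\<beta> (inv (\<alpha> u) a) = \<beta> a" for u a
    by blast
  show "\<forall>a u v. inv (\<beta> (\<alpha> u a)) u = inv (\<beta> (\<alpha> u (inv (\<alpha> v) a))) u"
    by (simp add: inv_\<beta> \<beta>_invariant[OF inv_\<beta>])
qed

lemma matched_product_system_iff: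
  "matched_product_system rS rT \<alpha> \<beta> \<longleftrightarrow>
     (\<forall>u. shelf_hom (\<triangleright>) (\<triangleright>) (\<alpha> u)) \<and> (\<forall>a. shelf_hom (\<triangleleft>) (\<triangleleft>) (\<beta> a)) \<and>
     (\<forall>u v. \<alpha> (v \<triangleleft> u) = \<alpha> u \<circ> \<alpha> v \<circ> inv (\<alpha> u)) \<and>
     (\<forall>a b. \<beta> (b \<triangleright> a) = inv (\<beta> b) \<circ> \<beta> a \<circ> \<beta> b) \<and>
     (\<forall>a u. \<alpha> (inv (\<beta> a) u) = \<alpha> u) \<and> (\<forall>u a. \<beta> (inv (\<alpha> u) a) = \<beta> a)"
  (is "_ \<longleftrightarrow> _ \<and> _ \<and> _ \<and> _ \<and> ?inv_\<alpha> \<and> ?inv_\<beta>")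
proof (cases "?inv_\<alpha> \<and> ?inv_\<beta>")
  case True
  then have inv_\<alpha>: "\<And>a u. \<alpha> (inv (\<beta> a) u) = \<alpha> u"
    and inv_\<beta>: "\<And>u a. \<beta> (inv (\<alpha> u) a) = \<beta> a"
    by blast+
  show ?thesis
    unfolding matched_product_system_iff_axioms \<alpha>_conjugation_iff \<beta>_conjugation_iff
      \<beta>_invariance_iff \<alpha>_hom_iff[OF inv_\<alpha>] \<beta>_hom_iff[OF inv_\<beta>]
    by argo
next
  case False
  then show ?thesis
    unfolding matched_product_system_iff_axioms \<beta>_invariance_iff by argo
qed

end

locale matched_shelf_pair = shelf_pair +
  assumes system: "matched_product_system rS rT \<alpha> \<beta>"
begin

lemma
  shows \<alpha>_conjugation: "\<alpha> (v \<triangleleft> u) = \<alpha> u \<circ> \<alpha> v \<circ> inv (\<alpha> u)"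
    and \<alpha>_inv_\<beta>: "\<alpha> (inv (\<beta> a) u) = \<alpha> u"
    and \<beta>_inv_\<alpha>: "\<beta> (inv (\<alpha> u) a) = \<beta> a"
    and \<beta>_hom: "shelf_hom (\<triangleleft>) (\<triangleleft>) (\<beta> a)"
  using system unfolding matched_product_system_iff by blast+

lemmas \<alpha>_\<beta> = \<alpha>_invariant[OF \<alpha>_inv_\<beta>] and \<beta>_\<alpha> = \<beta>_invariant[OF \<beta>_inv_\<alpha>]

lemma second_component: "\<beta> a (v \<triangleleft> inv (\<beta> a) u) = \<beta> a v \<triangleleft> u"
  using \<beta>_hom[of a] by (simp add: shelf_hom_def)

text \<open>
  The index \<open>\<beta>\<^sub>a(v) \<triangleleft> u\<close> of the \<open>\<alpha>\<close> in the third entry of the matched product may be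
  replaced by \<open>v \<triangleleft> u\<close>, since \<open>\<alpha>\<close> at either is the conjugate of \<open>\<alpha>\<^sub>v\<close> by \<open>\<alpha>\<^sub>u\<close>.
\<close>
lemma \<alpha>_index: "\<alpha> (\<beta> a v \<triangleleft> u) = \<alpha> (v \<triangleleft> u)"
  by (simp add: \<alpha>_conjugation \<alpha>_\<beta>)

lemma matched_product_eq:
  "matched_product rS rT \<alpha> \<beta> ((a, u), (b, v)) =
     ((\<alpha> u b, \<beta> a v \<triangleleft> u), (inv (\<alpha> (v \<triangleleft> u)) (\<alpha> u b \<triangleright> a), inv (\<beta> b) u))"
  by (simp add: matched_product_def Let_def components second_component
      \<alpha>_inv_\<beta> \<beta>_inv_\<alpha> \<beta>_\<alpha> \<alpha>_index)

lemma lam_matched_product: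
  "lam (matched_product rS rT \<alpha> \<beta>) (a, u) = map_prod (\<alpha> u) ((\<lambda>v. v \<triangleleft> u) \<circ> \<beta> a)"
  by (auto simp: lam_def matched_product_eq)

lemma left_nondegenerate_matched_product_iff:
  "left_nondegenerate (matched_product rS rT \<alpha> \<beta>) \<longleftrightarrow> right_rack (\<triangleleft>)"
proof -
  have "bij ((\<lambda>v. v \<triangleleft> u) \<circ> \<beta> a) \<longleftrightarrow> bij (\<lambda>v. v \<triangleleft> u)" for a u
  proof
    assume "bij ((\<lambda>v. v \<triangleleft> u) \<circ> \<beta> a)"
    then have "bij ((\<lambda>v. v \<triangleleft> u) \<circ> \<beta> a \<circ> inv (\<beta> a))"
      by (rule bij_comp[OF bij_imp_bij_inv[OF bij_\<beta>]])
    then show "bij (\<lambda>v. v \<triangleleft> u)"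
      by (simp add: comp_def)
  qed (rule bij_comp[OF bij_\<beta>])
  then show ?thesis
    by (simp add: left_nondegenerate_def lam_matched_product bij_map_prod_iff bij_\<alpha>
        right_rack_def right_shelf)
qed

end

theorem theorem8:
  fixes ls :: "'s \<Rightarrow> 's \<Rightarrow> 's"  (infixr "\<triangleright>" 70)
    and rs :: "'t \<Rightarrow> 't \<Rightarrow> 't"  (infixl "\<triangleleft>" 70)
    and rS :: "'s \<times> 's \<Rightarrow> 's \<times> 's"
    and rT :: "'t \<times> 't \<Rightarrow> 't \<times> 't"
    and \<alpha> :: "'t \<Rightarrow> 's \<Rightarrow> 's"
    and \<beta> :: "'s \<Rightarrow> 't \<Rightarrow> 't"
  assumes "left_shelf (\<triangleright>)"
    and "right_shelf (\<triangleleft>)"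
    and "rS = left_shelf_solution (\<triangleright>)"
    and "rT = right_shelf_solution (\<triangleleft>)"
    and "\<And>u. bij (\<alpha> u)"
    and "\<And>a. bij (\<beta> a)"
  shows "(matched_product_system rS rT \<alpha> \<beta> \<longleftrightarrow>
            (\<forall>u. shelf_hom (\<triangleright>) (\<triangleright>) (\<alpha> u)) \<and>
            (\<forall>a. shelf_hom (\<triangleleft>) (\<triangleleft>) (\<beta> a)) \<and>
            (\<forall>a b u v.
               \<alpha> (v \<triangleleft> u) = \<alpha> u \<circ> \<alpha> v \<circ> inv (\<alpha> u) \<and>
               \<beta> (b \<triangleright> a) = inv (\<beta> b) \<circ> \<beta> a \<circ> \<beta> b \<and>
               \<alpha> u = \<alpha> (inv (\<beta> a) u) \<and>
               \<beta> a = \<beta> (inv (\<alpha> u) a)))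
       \<and> (matched_product_system rS rT \<alpha> \<beta> \<longrightarrow>
            (\<forall>a b u v. matched_product rS rT \<alpha> \<beta> ((a, u), (b, v)) =
               ((\<alpha> u b, \<beta> a v \<triangleleft> u), (inv (\<alpha> (v \<triangleleft> u)) (\<alpha> u b \<triangleright> a), inv (\<beta> b) u)))
            \<and> (left_nondegenerate (matched_product rS rT \<alpha> \<beta>) \<longleftrightarrow> right_rack (\<triangleleft>)))"
proof -
  interpret shelf_pair "(\<triangleright>)" "(\<triangleleft>)" \<alpha> \<beta>
    using assms by unfold_locales
  have formula: "matched_product rS rT \<alpha> \<beta> ((a, u), (b, v)) =
      ((\<alpha> u b, \<beta> a v \<triangleleft> u), (inv (\<alpha> (v \<triangleleft> u)) (\<alpha> u b \<triangleright> a), inv (\<beta> b) u))"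
    and nondegenerate: "left_nondegenerate (matched_product rS rT \<alpha> \<beta>) \<longleftrightarrow> right_rack (\<triangleleft>)"
    if "matched_product_system rS rT \<alpha> \<beta>" for a b u v
  proof -
    interpret matched_shelf_pair "(\<triangleright>)" "(\<triangleleft>)" \<alpha> \<beta>
      using that assms(3,4) by unfold_locales simp
    show "matched_product rS rT \<alpha> \<beta> ((a, u), (b, v)) =
        ((\<alpha> u b, \<beta> a v \<triangleleft> u), (inv (\<alpha> (v \<triangleleft> u)) (\<alpha> u b \<triangleright> a), inv (\<beta> b) u))"
      unfolding assms(3,4) by (rule matched_product_eq)
    show "left_nondegenerate (matched_product rS rT \<alpha> \<beta>) \<longleftrightarrow> right_rack (\<triangleleft>)"
      unfolding assms(3,4) by (rule left_nondegenerate_matched_product_iff)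
  qed
  have "matched_product_system rS rT \<alpha> \<beta> \<longleftrightarrow>
      (\<forall>u. shelf_hom (\<triangleright>) (\<triangleright>) (\<alpha> u)) \<and> (\<forall>a. shelf_hom (\<triangleleft>) (\<triangleleft>) (\<beta> a)) \<and>
      (\<forall>a b u v.
         \<alpha> (v \<triangleleft> u) = \<alpha> u \<circ> \<alpha> v \<circ> inv (\<alpha> u) \<and>
         \<beta> (b \<triangleright> a) = inv (\<beta> b) \<circ> \<beta> a \<circ> \<beta> b \<and>
         \<alpha> u = \<alpha> (inv (\<beta> a) u) \<and>
         \<beta> a = \<beta> (inv (\<alpha> u) a))"
    unfolding assms(3,4) matched_product_system_iff by metis
  then show ?thesis
    using formula nondegenerate by simp
qed

end
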